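(* Consider a linear pHDAE $$E\dot z=(J-R)z+(G-P)u,\qquad y=(G+P)^Tz+(S-N)u$$ (i.e. with $Q=I$ and $K=0$) with quadratic Hamiltonian $\mathcal H(t,z)=\tfrac12z^TE(t)z$. If $V\in\mathbb R^{n,k}$ for some $k\in\mathbb N$, then the projected system (in the variable $z=V\tilde z$) $$\widetilde E\dot{\tilde z}=(\widetilde J-\widetilde R)\tilde z+(\widetilde G-\widetilde P)u,\qquad y=(\widetilde G+\widetilde P)^T\tilde z+(S-N)u,$$ with $\widetilde E=V^TEV$, $\widetilde J=V^TJV$, $\widetilde R=V^TRV$, $\widetilde G=V^TG$, $\widetilde P=V^TP$, is still a pHDAE, with projected Hamiltonian $\widetilde{\mathcal H}(\tilde z)=\tfrac12\tilde z^T\widetilde E\tilde z$.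
   Context: Linear pHDAE with quadratic Hamiltonian, $Q=I$, $K=0$, on a time interval $\mathbb T$: $E\in C^1(\mathbb T,\mathbb R^{n,n})$, $J,R\in C(\mathbb T,\mathbb R^{n,n})$, $G,P\in C(\mathbb T,\mathbb R^{n,m})$, $S=S^T$, $N=-N^T\in C(\mathbb T,\mathbb R^{m,m})$ such that (i) the operator $E\frac{\mathrm d}{\mathrm dt}-J$ is skew-adjoint, meaning that pointwise $E=E^T$ and $\dot E=-(J+J^T)$, and (ii) the matrix function $\begin{bmatrix}R&P\\P^T&S\end{bmatrix}$ is pointwise symmetric positive semi-definite. The associated Hamiltonian is $\mathcal H(t,z)=\tfrac12z^TE(t)z$. *)

theory Defs
  imports "HOL-Analysis.Analysis"
begin

text \<open>
  An \<open>n \<times> m\<close> matrix has type \<open>real ^ 'm ^ 'n\<close>. The state dimension is \<open>n = CARD('n)\<close> and the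
  input/output dimension is \<open>m = CARD('m)\<close>. The record collects the coefficient functions of
  \<open>E z' = (J - R) z + (G - P) u\<close>, \<open>y = (G + P)\<^sup>T z + (S - N) u\<close>; they matter only on the time
  interval.
\<close>

record ('n::finite, 'm::finite) descriptor_system =
  sys_E :: "real \<Rightarrow> real ^ 'n ^ 'n"
  sys_J :: "real \<Rightarrow> real ^ 'n ^ 'n"
  sys_R :: "real \<Rightarrow> real ^ 'n ^ 'n"
  sys_G :: "real \<Rightarrow> real ^ 'm ^ 'n"
  sys_P :: "real \<Rightarrow> real ^ 'm ^ 'n"
  sys_S :: "real \<Rightarrow> real ^ 'm ^ 'm"
  sys_N :: "real \<Rightarrow> real ^ 'm ^ 'm"

definition time_interval :: "real set \<Rightarrow> bool" where
  "time_interval T \<longleftrightarrow> is_interval T \<and> interior T \<noteq> {}"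

text \<open>Derivatives are taken within \<open>T\<close>, hence are one-sided at endpoints belonging to \<open>T\<close>;
  the library's \<open>C1_differentiable_on\<close> asks for two-sided derivatives there.\<close>

definition C1_within :: "real set \<Rightarrow> (real \<Rightarrow> 'a::real_normed_vector) \<Rightarrow> bool" where
  "C1_within T f \<longleftrightarrow>
     (\<exists>f'. (\<forall>t\<in>T. (f has_vector_derivative f' t) (at t within T)) \<and> continuous_on T f')"

definition block_matrix ::
  "real ^ 'n ^ 'n \<Rightarrow> real ^ 'm ^ 'n \<Rightarrow> real ^ 'n ^ 'm \<Rightarrow> real ^ 'm ^ 'm \<Rightarrow>
   real ^ ('n::finite + 'm::finite) ^ ('n + 'm)" where
  "block_matrix A B C D =
     (\<chi> i j. case i of
        Inl a \<Rightarrow> (case j of Inl b \<Rightarrow> A $ a $ b | Inr b \<Rightarrow> B $ a $ b)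
      | Inr a \<Rightarrow> (case j of Inl b \<Rightarrow> C $ a $ b | Inr b \<Rightarrow> D $ a $ b))"

definition sym_pos_semidef :: "real ^ 'n ^ 'n \<Rightarrow> bool" where
  "sym_pos_semidef A \<longleftrightarrow> transpose A = A \<and> (\<forall>x. 0 \<le> x \<bullet> (A *v x))"

definition skew_adjoint_on ::
  "real set \<Rightarrow> (real \<Rightarrow> real ^ 'n ^ 'n) \<Rightarrow> (real \<Rightarrow> real ^ 'n ^ 'n) \<Rightarrow> bool" where
  \<comment> \<open>skew-adjointness of the differential operator \<open>E d/dt - J\<close>\<close>
  "skew_adjoint_on T E J \<longleftrightarrow>
     (\<forall>t\<in>T. transpose (E t) = E t \<and>
            (E has_vector_derivative - (J t + transpose (J t))) (at t within T))"

definition linear_pHDAE :: "real set \<Rightarrow> ('n::finite, 'm::finite) descriptor_system \<Rightarrow> bool" where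
  "linear_pHDAE T \<Sigma> \<longleftrightarrow>
     time_interval T \<and>
     C1_within T (sys_E \<Sigma>) \<and>
     continuous_on T (sys_J \<Sigma>) \<and> continuous_on T (sys_R \<Sigma>) \<and>
     continuous_on T (sys_G \<Sigma>) \<and> continuous_on T (sys_P \<Sigma>) \<and>
     continuous_on T (sys_S \<Sigma>) \<and> continuous_on T (sys_N \<Sigma>) \<and>
     (\<forall>t\<in>T. sys_S \<Sigma> t = transpose (sys_S \<Sigma> t)) \<and>
     (\<forall>t\<in>T. sys_N \<Sigma> t = - transpose (sys_N \<Sigma> t)) \<and>
     skew_adjoint_on T (sys_E \<Sigma>) (sys_J \<Sigma>) \<and>
     (\<forall>t\<in>T. sym_pos_semidef
        (block_matrix (sys_R \<Sigma> t) (sys_P \<Sigma> t) (transpose (sys_P \<Sigma> t)) (sys_S \<Sigma> t)))"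

definition hamiltonian ::
  "('n::finite, 'm::finite) descriptor_system \<Rightarrow> real \<Rightarrow> real ^ 'n \<Rightarrow> real" where
  "hamiltonian \<Sigma> t z = 1/2 * (z \<bullet> (sys_E \<Sigma> t *v z))"

definition output_equation ::
  "real set \<Rightarrow> ('n::finite, 'm::finite) descriptor_system \<Rightarrow>
   (real \<Rightarrow> real ^ 'm) \<Rightarrow> (real \<Rightarrow> real ^ 'n) \<Rightarrow> (real \<Rightarrow> real ^ 'm) \<Rightarrow> bool" where
  "output_equation T \<Sigma> u z y \<longleftrightarrow>
     (\<forall>t\<in>T. y t = transpose (sys_G \<Sigma> t + sys_P \<Sigma> t) *v z t + (sys_S \<Sigma> t - sys_N \<Sigma> t) *v u t)"

definition residual ::
  "real set \<Rightarrow> ('n::finite, 'm::finite) descriptor_system \<Rightarrow>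
   (real \<Rightarrow> real ^ 'm) \<Rightarrow> (real \<Rightarrow> real ^ 'n) \<Rightarrow> real \<Rightarrow> real ^ 'n" where
  "residual T \<Sigma> u z t =
     sys_E \<Sigma> t *v vector_derivative z (at t within T)
     - ((sys_J \<Sigma> t - sys_R \<Sigma> t) *v z t + (sys_G \<Sigma> t - sys_P \<Sigma> t) *v u t)"

definition solves ::
  "real set \<Rightarrow> ('n::finite, 'm::finite) descriptor_system \<Rightarrow>
   (real \<Rightarrow> real ^ 'm) \<Rightarrow> (real \<Rightarrow> real ^ 'n) \<Rightarrow> (real \<Rightarrow> real ^ 'm) \<Rightarrow> bool" where
  "solves T \<Sigma> u z y \<longleftrightarrow>
     z differentiable_on T \<and>
     (\<forall>t\<in>T. sys_E \<Sigma> t *v vector_derivative z (at t within T)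
            = (sys_J \<Sigma> t - sys_R \<Sigma> t) *v z t + (sys_G \<Sigma> t - sys_P \<Sigma> t) *v u t) \<and>
     output_equation T \<Sigma> u z y"

text \<open>Galerkin projection: the ansatz \<open>z = V w\<close> is inserted into the system and the state equation
  is tested from the left with \<open>V\<^sup>T\<close>. No rank condition is imposed on \<open>V\<close>.\<close>

definition galerkin_solves ::
  "real set \<Rightarrow> real ^ 'k ^ 'n \<Rightarrow> ('n::finite, 'm::finite) descriptor_system \<Rightarrow>
   (real \<Rightarrow> real ^ 'm) \<Rightarrow> (real \<Rightarrow> real ^ 'k::finite) \<Rightarrow> (real \<Rightarrow> real ^ 'm) \<Rightarrow> bool" where
  "galerkin_solves T V \<Sigma> u w y \<longleftrightarrow>
     w differentiable_on T \<and>
     (\<forall>t\<in>T. transpose V *v residual T \<Sigma> u (\<lambda>s. V *v w s) t = 0) \<and>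
     output_equation T \<Sigma> u (\<lambda>s. V *v w s) y"

definition projected_system ::
  "real ^ 'k ^ 'n \<Rightarrow> ('n::finite, 'm::finite) descriptor_system \<Rightarrow>
   ('k::finite, 'm) descriptor_system" where
  "projected_system V \<Sigma> =
     \<lparr> sys_E = (\<lambda>t. transpose V ** sys_E \<Sigma> t ** V),
       sys_J = (\<lambda>t. transpose V ** sys_J \<Sigma> t ** V),
       sys_R = (\<lambda>t. transpose V ** sys_R \<Sigma> t ** V),
       sys_G = (\<lambda>t. transpose V ** sys_G \<Sigma> t),
       sys_P = (\<lambda>t. transpose V ** sys_P \<Sigma> t),
       sys_S = sys_S \<Sigma>,
       sys_N = sys_N \<Sigma> \<rparr>"

end

theory Submission
  imports Defs
begin

text \<open>
  The conditions that define a pHDAE survive the congruence \<open>A \<mapsto> V\<^sup>T A V\<close> of \<open>E\<close>, \<open>J\<close>, \<open>R\<close> with a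
  constant matrix \<open>V\<close>; the coefficients \<open>S\<close> and \<open>N\<close> are unchanged. This map is linear and commutes with transposition, so
  it preserves continuity, \<open>C\<^sup>1\<close> regularity and skew-adjointness (lemma
  \<open>skew_adjoint_on_congruence\<close>). The dissipation matrix of the projected system is the congruence of
  the original one with \<open>diag(V, I)\<close>; its quadratic form at \<open>(w, u)\<close> is therefore the original
  quadratic form at \<open>(V w, u)\<close>, which is nonnegative
  (lemma \<open>sym_pos_semidef_block_congruence\<close>). None of this needs \<open>V\<close> to have full rank.

  The projected equations are the Galerkin equations because \<open>(V w)' = V w'\<close>; here the time interval
  must be nondegenerate, so that derivatives within it are unique. The Hamiltonian
  identity is the same congruence applied to the quadratic form of \<open>E\<close>.
\<close>

lemma matrix_add_rdistrib:
  fixes A B :: "'a::semiring_1 ^ 'n ^ 'm"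
  shows "(A + B) ** C = A ** C + B ** C"
  by (vector matrix_matrix_mult_def sum.distrib[symmetric] distrib_right)

lemma bounded_linear_congruence:
  fixes V :: "real ^ 'k ^ 'n"
  shows "bounded_linear (\<lambda>A. transpose V ** A ** V)"
  unfolding linear_conv_bounded_linear[symmetric]
  by (rule linearI)
     (simp_all add: matrix_add_ldistrib matrix_add_rdistrib matrix_scalar_ac scalar_matrix_assoc)

lemma bounded_linear_matrix_mult_left:
  fixes A :: "real ^ 'n ^ 'k"
  shows "bounded_linear (\<lambda>B :: real ^ 'm ^ 'n. A ** B)"
  unfolding linear_conv_bounded_linear[symmetric]
  by (rule linearI) (simp_all add: matrix_add_ldistrib matrix_scalar_ac scalar_matrix_assoc)

lemma transpose_congruence:
  fixes V :: "real ^ 'k ^ 'n"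
  shows "transpose (transpose V ** A ** V) = transpose V ** transpose A ** V"
  by (simp add: matrix_transpose_mul matrix_mul_assoc)

lemma inner_transpose_mult:
  fixes V :: "real ^ 'k ^ 'n"
  shows "w \<bullet> (transpose V *v x) = (V *v w) \<bullet> x"
  by (simp add: inner_commute[of w] inner_commute[of "V *v w"] dot_lmul_matrix)

lemma quadratic_form_congruence:
  fixes V :: "real ^ 'k ^ 'n"
  shows "w \<bullet> ((transpose V ** A ** V) *v w) = (V *v w) \<bullet> (A *v (V *v w))"
  by (simp add: inner_transpose_mult flip: matrix_vector_mul_assoc del: transpose_matrix_vector)

lemma C1_within_bounded_linear:
  assumes "bounded_linear h" and "C1_within T f"
  shows "C1_within T (\<lambda>t. h (f t))"
proof -
  obtain f' where f': "\<And>t. t \<in> T \<Longrightarrow> (f has_vector_derivative f' t) (at t within T)"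
    and cont: "continuous_on T f'"
    using assms(2) unfolding C1_within_def by auto
  have "((\<lambda>t. h (f t)) has_vector_derivative h (f' t)) (at t within T)" if "t \<in> T" for t
    by (rule bounded_linear.has_vector_derivative[OF assms(1) f'[OF that]])
  moreover have "continuous_on T (\<lambda>t. h (f' t))"
    by (rule bounded_linear.continuous_on[OF assms(1) cont])
  ultimately show ?thesis
    unfolding C1_within_def by (intro exI[of _ "\<lambda>t. h (f' t)"]) simp
qed

lemma skew_adjoint_on_congruence:
  fixes V :: "real ^ 'k ^ 'n"
  assumes "skew_adjoint_on T E J"
  shows "skew_adjoint_on T (\<lambda>t. transpose V ** E t ** V) (\<lambda>t. transpose V ** J t ** V)"
  unfolding skew_adjoint_on_def
proof (intro ballI conjI)
  fix t assume t: "t \<in> T"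
  interpret congr: bounded_linear "\<lambda>A. transpose V ** A ** V"
    by (rule bounded_linear_congruence)
  show "transpose (transpose V ** E t ** V) = transpose V ** E t ** V"
    using assms t by (simp add: skew_adjoint_on_def transpose_congruence)
  have "(E has_vector_derivative - (J t + transpose (J t))) (at t within T)"
    using assms t by (simp add: skew_adjoint_on_def)
  from congr.has_vector_derivative[OF this]
  show "((\<lambda>t. transpose V ** E t ** V) has_vector_derivative
      - (transpose V ** J t ** V + transpose (transpose V ** J t ** V))) (at t within T)"
    by (simp only: congr.neg congr.add transpose_congruence)
qed

lemma sum_UNIV_Plus:
  fixes f :: "'a::finite + 'b::finite \<Rightarrow> 'c::comm_monoid_add"
  shows "sum f UNIV = (\<Sum>a\<in>UNIV. f (Inl a)) + (\<Sum>b\<in>UNIV. f (Inr b))"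
  using sum.Plus[of "UNIV :: 'a set" "UNIV :: 'b set" f] by simp

lemma quadratic_form_block_matrix:
  fixes x :: "real ^ ('n::finite + 'm::finite)"
  defines "w \<equiv> (\<chi> a. x $ Inl a)" and "u \<equiv> (\<chi> b. x $ Inr b)"
  shows "x \<bullet> (block_matrix A B C D *v x) =
    w \<bullet> (A *v w) + w \<bullet> (B *v u) + (u \<bullet> (C *v w) + u \<bullet> (D *v u))"
  by (simp add: inner_vec_def matrix_vector_mult_def block_matrix_def w_def u_def sum_UNIV_Plus
      distrib_left sum.distrib)

lemma transpose_block_matrix:
  "transpose (block_matrix A B C D) =
    block_matrix (transpose A) (transpose C) (transpose B) (transpose D)"
  by (simp add: vec_eq_iff transpose_def block_matrix_def split_sum_all)

lemma block_matrix_eq_iff: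
  "block_matrix A B C D = block_matrix A' B' C' D' \<longleftrightarrow> A = A' \<and> B = B' \<and> C = C' \<and> D = D'"
  by (simp add: vec_eq_iff block_matrix_def split_sum_all all_conj_distrib)

lemma sym_pos_semidef_block_congruence:
  fixes V :: "real ^ 'k::finite ^ 'n::finite" and P :: "real ^ 'm::finite ^ 'n"
  assumes psd: "sym_pos_semidef (block_matrix R P (transpose P) S)"
  shows "sym_pos_semidef
    (block_matrix (transpose V ** R ** V) (transpose V ** P) (transpose (transpose V ** P)) S)"
  unfolding sym_pos_semidef_def
proof (intro conjI allI)
  have sym: "transpose R = R" "transpose S = S"
    using psd by (simp_all add: sym_pos_semidef_def transpose_block_matrix block_matrix_eq_iff)
  then show "transpose (block_matrix (transpose V ** R ** V) (transpose V ** P)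
      (transpose (transpose V ** P)) S) =
    block_matrix (transpose V ** R ** V) (transpose V ** P) (transpose (transpose V ** P)) S"
    by (simp add: transpose_block_matrix transpose_congruence)
next
  fix x :: "real ^ ('k + 'm)"
  define w u where "w = (\<chi> a. x $ Inl a)" and "u = (\<chi> b. x $ Inr b)"
  \<comment> \<open>the image \<open>(V w, u)\<close> of \<open>x = (w, u)\<close> under \<open>diag(V, I)\<close>\<close>
  define x' :: "real ^ ('n + 'm)"
    where "x' = (\<chi> i. case i of Inl a \<Rightarrow> (V *v w) $ a | Inr b \<Rightarrow> u $ b)"
  have x': "(\<chi> a. x' $ Inl a) = V *v w" "(\<chi> b. x' $ Inr b) = u"
    by (simp_all add: x'_def)
  have "w \<bullet> ((transpose V ** P) *v u) = (V *v w) \<bullet> (P *v u)"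
    by (simp add: inner_transpose_mult flip: matrix_vector_mul_assoc del: transpose_matrix_vector)
  moreover have "transpose (transpose V ** P) *v w = transpose P *v (V *v w)"
    by (simp add: matrix_transpose_mul matrix_vector_mul_assoc del: transpose_matrix_vector)
  ultimately have "x \<bullet> (block_matrix (transpose V ** R ** V) (transpose V ** P)
      (transpose (transpose V ** P)) S *v x) = x' \<bullet> (block_matrix R P (transpose P) S *v x')"
    unfolding quadratic_form_block_matrix x' w_def[symmetric] u_def[symmetric]
      quadratic_form_congruence by simp
  then show "0 \<le> x \<bullet> (block_matrix (transpose V ** R ** V) (transpose V ** P)
      (transpose (transpose V ** P)) S *v x)"
    using psd by (simp add: sym_pos_semidef_def)
qed

lemma linear_pHDAE_projected_system:
  assumes "linear_pHDAE T \<Sigma>"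
  shows "linear_pHDAE T (projected_system V \<Sigma>)"
  using assms unfolding linear_pHDAE_def projected_system_def descriptor_system.select_convs
  \<comment> \<open>The simplifier would loop on the hypotheses \<open>S = S\<^sup>T\<close> and \<open>N = - N\<^sup>T\<close>, used as rewrite rules.\<close>
  by (elim conjE, intro conjI)
     (assumption
      | rule C1_within_bounded_linear[OF bounded_linear_congruence]
          bounded_linear.continuous_on[OF bounded_linear_congruence]
          bounded_linear.continuous_on[OF bounded_linear_matrix_mult_left]
          skew_adjoint_on_congruence
      | blast intro: sym_pos_semidef_block_congruence)+

lemma time_interval_at_within_neq_bot:
  assumes "time_interval T" and "t \<in> T"
  shows "at t within T \<noteq> bot"
proof -
  have "T \<noteq> {t}"
    using assms(1) by (auto simp: time_interval_def)
  moreover have "connected T"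
    using assms(1) by (simp add: time_interval_def is_interval_connected)
  ultimately have "t islimpt T"
    using assms(2) by (intro connected_imp_perfect) auto
  then show ?thesis
    by (simp add: trivial_limit_within)
qed

lemma vector_derivative_matrix_vector_mult:
  fixes V :: "real ^ 'k ^ 'n"
  assumes "time_interval T" and "w differentiable_on T" and "t \<in> T"
  shows "vector_derivative (\<lambda>s. V *v w s) (at t within T) =
    V *v vector_derivative w (at t within T)"
proof (rule vector_derivative_within)
  show "at t within T \<noteq> bot"
    using assms(1,3) by (rule time_interval_at_within_neq_bot)
  have "(w has_vector_derivative vector_derivative w (at t within T)) (at t within T)"
    using assms(2,3) by (simp add: differentiable_on_def vector_derivative_works)
  then show "((\<lambda>s. V *v w s) has_vector_derivative
      V *v vector_derivative w (at t within T)) (at t within T)"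
    by (rule bounded_linear.has_vector_derivative[OF matrix_vector_mul_bounded_linear])
qed

lemma output_equation_projected_system:
  fixes V :: "real ^ 'k::finite ^ 'n::finite" and \<Sigma> :: "('n, 'm::finite) descriptor_system"
  shows "output_equation T (projected_system V \<Sigma>) u w y \<longleftrightarrow>
    output_equation T \<Sigma> u (\<lambda>s. V *v w s) y"
proof -
  have "transpose (transpose V ** G + transpose V ** P) = transpose (G + P) ** V"
    for G P :: "real ^ 'm ^ 'n"
    by (simp add: matrix_transpose_mul flip: matrix_add_ldistrib)
  then show ?thesis
    by (simp add: output_equation_def projected_system_def matrix_vector_mul_assoc
        del: transpose_matrix_vector)
qed

lemma transpose_mult_residual:
  assumes "time_interval T" and "w differentiable_on T" and "t \<in> T"
  shows "transpose V *v residual T \<Sigma> u (\<lambda>s. V *v w s) t =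
    residual T (projected_system V \<Sigma>) u w t"
  by (simp add: residual_def projected_system_def vector_derivative_matrix_vector_mult[OF assms]
      matrix_vector_mult_diff_rdistrib matrix_vector_mult_diff_distrib
      matrix_vector_right_distrib flip: matrix_vector_mul_assoc
      del: transpose_matrix_vector)

lemma solves_projected_system_iff:
  assumes "time_interval T"
  shows "solves T (projected_system V \<Sigma>) u w y \<longleftrightarrow> galerkin_solves T V \<Sigma> u w y"
proof -
  have "transpose V *v residual T \<Sigma> u (\<lambda>s. V *v w s) t = 0 \<longleftrightarrow>
      residual T (projected_system V \<Sigma>) u w t = 0"
    if "w differentiable_on T" "t \<in> T" for t
    by (simp only: transpose_mult_residual[OF assms that])
  then show ?thesis
    unfolding solves_def galerkin_solves_def output_equation_projected_system
    by (auto simp only: residual_def right_minus_eq)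
qed

lemma hamiltonian_projected_system:
  "hamiltonian (projected_system V \<Sigma>) t w = 1/2 * (w \<bullet> ((transpose V ** sys_E \<Sigma> t ** V) *v w))"
  by (simp add: hamiltonian_def projected_system_def)

theorem corollary6p5:
  fixes T :: "real set"
    and \<Sigma> :: "('n::finite, 'm::finite) descriptor_system"
    and V :: "real ^ 'k::finite ^ 'n"
  assumes "linear_pHDAE T \<Sigma>"
  shows "linear_pHDAE T (projected_system V \<Sigma>) \<and>
    (\<forall>u w y. solves T (projected_system V \<Sigma>) u w y \<longleftrightarrow> galerkin_solves T V \<Sigma> u w y) \<and>
    (\<forall>t\<in>T. \<forall>w. hamiltonian (projected_system V \<Sigma>) t w
        = 1/2 * (w \<bullet> ((transpose V ** sys_E \<Sigma> t ** V) *v w))) \<and>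
    (\<forall>t\<in>T. \<forall>w. hamiltonian (projected_system V \<Sigma>) t w = hamiltonian \<Sigma> t (V *v w))"
proof (intro conjI ballI allI)
  show "linear_pHDAE T (projected_system V \<Sigma>)"
    using assms by (rule linear_pHDAE_projected_system)
  have "time_interval T"
    using assms by (simp add: linear_pHDAE_def)
  then show "solves T (projected_system V \<Sigma>) u w y \<longleftrightarrow> galerkin_solves T V \<Sigma> u w y" for u w y
    by (rule solves_projected_system_iff)
  show "hamiltonian (projected_system V \<Sigma>) t w
      = 1/2 * (w \<bullet> ((transpose V ** sys_E \<Sigma> t ** V) *v w))" for t w
    by (rule hamiltonian_projected_system)
  show "hamiltonian (projected_system V \<Sigma>) t w = hamiltonian \<Sigma> t (V *v w)" for t w
    by (simp add: hamiltonian_projected_system quadratic_form_congruence) (simp add: hamiltonian_def)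
qed

end
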